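(* Let $C_1,\dots,C_T\in\mathbb{R}^{n\times n}$ be symmetric with $0\preceq C_t\preceq I$, $T\ge1$, and let $\mathcal{B}^n_1$ be the probability simplex in $\mathbb{R}^n$. Start from $y_1\in\mathcal{B}^n_1$ and for $t=1,\dots,T$, incur the loss $y_t^\top C_ty_t$ and update $$v_{t+1,i}=\frac{y_{t,i}\exp(-\eta(C_ty_t)_i)}{\sum_jy_{t,j}\exp(-\eta(C_ty_t)_j)},\qquad y_{t+1,i}=\frac\alpha n+(1-\alpha)v_{t+1,i}.$$ Suppose $L>0$ satisfies $\min_{u\in\mathcal{B}^n_1}\sum_{t=r}^su^\top C_tu\le L$ for all $1\le r\le s\le T$, and set $\alpha=\frac1{T+1}$, $c=\frac{\sqrt{2\ln((1+T)n)+2}}{\sqrt L}$, $b=\frac c2$, $a=\frac b{2b+1}$, $\eta=2a$. Then $$\max_{[r,s]\subset[1,T]}\Big\{\sum_{t=r}^sy_t^\top C_ty_t-\min_{u\in\mathcal{B}^n_1}\sum_{t=r}^su^\top C_tu\Big\}\le2\sqrt{2L\big(\ln((1+T)n)+1\big)}+2\ln((1+T)n).$$ *)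

theory Defs
  imports "HOL-Analysis.Analysis"
begin

definition psd :: "real^'n^'n \<Rightarrow> bool" where
  "psd A \<longleftrightarrow> (\<forall>x. 0 \<le> x \<bullet> (A *v x))"

definition loewner_le :: "real^'n^'n \<Rightarrow> real^'n^'n \<Rightarrow> bool" where
  "loewner_le A B \<longleftrightarrow> psd (B - A)"

definition prob_simplex :: "(real^'n) set" where
  "prob_simplex = {u. (\<forall>i. 0 \<le> u $ i) \<and> (\<Sum>i\<in>UNIV. u $ i) = 1}"

definition min_loss :: "(nat \<Rightarrow> real^'n^'n) \<Rightarrow> nat \<Rightarrow> nat \<Rightarrow> real" where
  "min_loss C r s = (INF u\<in>prob_simplex. \<Sum>t=r..s. u \<bullet> (C t *v u))"

end

theory Submission
  imports Defs "HOL-Probability.Hoeffding"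
begin

text \<open>
  For symmetric \<open>0 \<le> C \<le> I\<close> and \<open>p = y \<bullet> C y\<close>, the Cauchy-Schwarz inequality of the form \<open>C\<close> gives
  \<open>((C y)\<^sub>i - (C y)\<^sub>j)\<^sup>2 \<le> 2 p\<close>, so Hoeffding's lemma bounds the logarithm of the normalizer of the
  multiplicative update by \<open>- \<eta> p + \<eta>\<^sup>2 p / 4\<close>. Together with \<open>u \<bullet> C y \<le> \<theta> p / 2 + u \<bullet> C u / (2 \<theta>)\<close>
  this yields a per-step inequality between \<open>p\<close>, \<open>u \<bullet> C u\<close> and the decrease of the cross entropy
  \<open>- \<Sum> u\<^sub>i ln y\<^sub>i\<close>, which telescopes up to the mixing cost. After a mixing step the cross entropy is
  at most \<open>D = ln ((1 + T) n)\<close>.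

  The coarser estimate \<open>- \<eta> p + \<eta>\<^sup>2 p / 2\<close> would only give the regret bound with
  \<open>2 D + 2\<close> in place of \<open>2 D\<close>. Moreover \<open>y 1\<close> may have zero coordinates, where the cross entropy is
  infinite, so the first round is charged its full loss of at most 1. Both are absorbed by the slack
  of the sharper estimate, provided \<open>D \<ge> 3/2 + 2 \<delta>\<close> for the accumulated mixing cost \<open>\<delta>\<close>;
  this holds for all \<open>n, T \<ge> 2\<close>.
\<close>

section \<open>Hoeffding's lemma for finite weighted sums\<close>

text \<open>Hoeffding's lemma applied to \<open>- X\<close> under the distribution with weights
  \<open>p\<close>. Pairwise differences stand in for the length of the enclosing interval.\<close>

lemma exp_mgf_bound_finite:
  fixes p X :: "'n::finite \<Rightarrow> real"
  assumes p0: "\<And>i. 0 \<le> p i" and p1: "(\<Sum>i\<in>UNIV. p i) = 1"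
    and width: "\<And>i j. (X i - X j)\<^sup>2 \<le> R" and h: "h > 0"
  shows "(\<Sum>i\<in>UNIV. p i * exp (- h * X i)) \<le> exp (- h * (\<Sum>i\<in>UNIV. p i * X i) + h\<^sup>2 * R / 8)"
proof -
  define M where "M = embed_pmf p"
  have nn: "(\<integral>\<^sup>+x. ennreal (p x) \<partial>count_space UNIV) = 1"
    using p1 by (simp add: nn_integral_count_space_finite sum_ennreal p0)
  have pmf: "pmf M i = p i" for i
    unfolding M_def by (rule pmf_embed_pmf[OF p0 nn])
  define a b where "a = Min (range (\<lambda>i. - X i))" and "b = Max (range (\<lambda>i. - X i))"
  have E: "measure_pmf.expectation M f = (\<Sum>i\<in>UNIV. p i * f i)" for f :: "'n \<Rightarrow> real"
    by (subst integral_measure_pmf[of UNIV]) (auto simp: pmf)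
  interpret interval_bounded_random_variable "measure_pmf M" "\<lambda>i. - X i" a b
    by unfold_locales (auto simp: a_def b_def)
  \<comment> \<open>Both endpoints are attained, so \<open>b - a\<close> is a difference of two
    values of \<open>X\<close> and \<open>width\<close> applies.\<close>
  have "a \<in> range (\<lambda>i. - X i)" "b \<in> range (\<lambda>i. - X i)"
    unfolding a_def b_def by (intro Min_in Max_in; simp)+
  then obtain i j where "a = - X i" "b = - X j"
    by blast
  then have ab: "(b - a)\<^sup>2 \<le> R"
    using width[of i j] by simp
  define m where "m = (\<Sum>i\<in>UNIV. p i * X i)"
  have mu: "measure_pmf.expectation M (\<lambda>i. - X i) = - m"
    by (simp add: E m_def sum_negf)
  have "ennreal (\<Sum>i\<in>UNIV. p i * exp (h * (- X i + m))) = (\<integral>\<^sup>+x. exp (h * (- X x - - m)) \<partial>measure_pmf M)"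
    by (subst nn_integral_measure_pmf_finite)
       (auto simp: pmf ennreal_mult'' mult.commute p0 sum_nonneg simp flip: sum_ennreal intro!: sum.mono_neutral_right
         simp: set_pmf_iff)
  also have "\<dots> \<le> ennreal (exp (h\<^sup>2 * (b - a)\<^sup>2 / 8))"
    using Hoeffdings_lemma_nn_integral[OF h] unfolding mu .
  finally have "(\<Sum>i\<in>UNIV. p i * exp (h * (- X i + m))) \<le> exp (h\<^sup>2 * (b - a)\<^sup>2 / 8)"
    by simp
  also have "\<dots> \<le> exp (h\<^sup>2 * R / 8)"
    using ab by (simp add: mult_left_mono)
  finally have "(\<Sum>i\<in>UNIV. p i * exp (h * (- X i + m))) * exp (- h * m) \<le> exp (h\<^sup>2 * R / 8) * exp (- h * m)"
    by (simp add: mult_right_mono)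
  also have "(\<Sum>i\<in>UNIV. p i * exp (h * (- X i + m))) * exp (- h * m) = (\<Sum>i\<in>UNIV. p i * exp (- h * X i))"
    by (simp add: sum_distrib_right mult.assoc right_diff_distrib flip: exp_add)
  finally show ?thesis
    by (simp add: m_def add.commute flip: exp_add)
qed

section \<open>Quadratic forms of symmetric matrices between 0 and the identity\<close>

lemma bilinear_symmetric:
  fixes A :: "real^'n^'n"
  assumes "transpose A = A"
  shows "x \<bullet> (A *v y) = y \<bullet> (A *v x)"
  by (metis assms dot_lmul_matrix inner_commute vector_transpose_matrix)

text \<open>Expand the form at \<open>k y - x\<close> and divide by \<open>2 k\<close>. The free
  weight \<open>k\<close> trades the loss of the learner against that of the comparator.\<close>

lemma psd_bilinear_AM_GM:
  fixes A :: "real^'n^'n"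
  assumes sym: "transpose A = A" and psd: "psd A" and k: "k > 0"
  shows "x \<bullet> (A *v y) \<le> k / 2 * (y \<bullet> (A *v y)) + 1 / (2 * k) * (x \<bullet> (A *v x))"
proof -
  have "0 \<le> (k *\<^sub>R y - x) \<bullet> (A *v (k *\<^sub>R y - x))"
    using psd by (simp add: psd_def)
  also have "\<dots> = k\<^sup>2 * (y \<bullet> (A *v y)) - 2 * k * (x \<bullet> (A *v y)) + x \<bullet> (A *v x)"
    by (simp add: matrix_vector_mult_diff_distrib inner_diff_left inner_diff_right
        matrix_vector_mult_scaleR bilinear_symmetric[OF sym, of y x] algebra_simps power2_eq_square)
  finally show ?thesis
    using k by (simp add: field_simps power2_eq_square)
qed

text \<open>The form at \<open>t y + x\<close> is a polynomial in \<open>t\<close> that is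
  nonnegative everywhere. Its leading coefficient may vanish, since \<open>A\<close> is only
  semidefinite; hence the case split.\<close>

lemma psd_Cauchy_Schwarz:
  fixes A :: "real^'n^'n"
  assumes sym: "transpose A = A" and psd: "psd A"
  shows "(x \<bullet> (A *v y))\<^sup>2 \<le> (x \<bullet> (A *v x)) * (y \<bullet> (A *v y))"
proof -
  let ?p = "y \<bullet> (A *v y)" and ?q = "x \<bullet> (A *v y)" and ?r = "x \<bullet> (A *v x)"
  have q: "0 \<le> ?p * t\<^sup>2 + 2 * ?q * t + ?r" for t
  proof -
    have "0 \<le> (t *\<^sub>R y + x) \<bullet> (A *v (t *\<^sub>R y + x))"
      using psd by (simp add: psd_def)
    then show ?thesis
      by (simp add: matrix_vector_right_distrib inner_add_left inner_add_right
        matrix_vector_mult_scaleR bilinear_symmetric[OF sym, of y x] algebra_simps power2_eq_square)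
  qed
  have nonneg: "0 \<le> ?p" "0 \<le> ?r" using psd by (auto simp: psd_def)
  show ?thesis
  proof (cases "?p = 0")
    case True
    have "?q = 0"
    proof (rule ccontr)
      assume "?q \<noteq> 0"
      \<comment> \<open>With \<open>?p = 0\<close> the polynomial is affine, and at this point its
        value is -1.\<close>
      then show False
        using q[of "- (?r + 1) / (2 * ?q)"] True by simp
    qed
    then show ?thesis using True by simp
  next
    case False
    then have "0 < ?p" using nonneg by simp
    \<comment> \<open>The point \<open>- ?q / ?p\<close> minimizes the quadratic.\<close>
    then show ?thesis
      using q[of "- ?q / ?p"]
      by (simp add: field_simps power2_eq_square)
  qed
qed

lemma quadratic_form_le_norm:
  fixes A :: "real^'n^'n"
  assumes "loewner_le A (mat 1)"
  shows "x \<bullet> (A *v x) \<le> x \<bullet> x"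
  using assms by (auto simp: loewner_le_def psd_def matrix_vector_mult_diff_rdistrib inner_diff_right)

text \<open>Cauchy-Schwarz against a difference of two unit vectors, whose squared norm is 2, or 0
  if \<open>i = j\<close>. The spread of the gradient is thus controlled by the loss itself, which
  is what makes the regret depend on \<open>L\<close> rather than on the interval length.\<close>

lemma mult_vec_coordinate_range:
  fixes A :: "real^'n^'n"
  assumes sym: "transpose A = A" and psd: "psd A" and le: "loewner_le A (mat 1)"
  shows "((A *v y) $ i - (A *v y) $ j)\<^sup>2 \<le> 2 * (y \<bullet> (A *v y))"
proof -
  define d :: "real^'n" where "d = axis i 1 - axis j 1"
  have "((A *v y) $ i - (A *v y) $ j)\<^sup>2 = (d \<bullet> (A *v y))\<^sup>2"
    by (simp add: d_def inner_diff_left inner_axis')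
  also have "\<dots> \<le> (d \<bullet> (A *v d)) * (y \<bullet> (A *v y))"
    by (rule psd_Cauchy_Schwarz[OF sym psd])
  also have "d \<bullet> (A *v d) \<le> d \<bullet> d"
    by (rule quadratic_form_le_norm[OF le])
  also have "d \<bullet> d \<le> 2"
    by (simp add: d_def inner_diff_left inner_diff_right inner_axis_axis)
  finally show ?thesis
    using psd by (simp add: psd_def mult_right_mono)
qed

section \<open>Telescoping, and numerical bounds for the logarithm\<close>

text \<open>\<open>F\<close> and \<open>V\<close> play the potential before and after the
  multiplicative update; mixing between consecutive rounds costs at most \<open>\<mu>\<close>. Only
  \<open>s - r\<close> mixing steps are charged, because the one after round \<open>s\<close> is
  never reached.\<close>

lemma telescoping_with_cost:
  fixes g F V :: "nat \<Rightarrow> real"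
  assumes "r \<le> s"
    and "\<And>t. r \<le> t \<Longrightarrow> t \<le> s \<Longrightarrow> g t \<le> F t - V t"
    and "\<And>t. r \<le> t \<Longrightarrow> t < s \<Longrightarrow> F (Suc t) \<le> V t + \<mu>"
  shows "(\<Sum>t=r..s. g t) \<le> F r - V s + real (s - r) * \<mu>"
  using assms
proof (induction s rule: dec_induct)
  case (step s)
  have "(\<Sum>t=r..s. g t) \<le> F r - V s + real (s - r) * \<mu>"
    using step by simp
  moreover have "F (Suc s) \<le> V s + \<mu>" "g (Suc s) \<le> F (Suc s) - V (Suc s)"
    using step by auto
  ultimately show ?case
    using step.hyps by (simp add: Suc_diff_le algebra_simps)
qed simp

text \<open>\<open>ln x\<close> is convex as a function of \<open>1 / x\<close>; this is its tangent
  at \<open>1 / x0\<close>.\<close>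

lemma ln_tangent: "0 < x \<Longrightarrow> 0 < x0 \<Longrightarrow> ln x \<ge> ln x0 + 1 - x0 / x" for x x0 :: real
  using ln_le_minus_one[of "x0 / x"] by (simp add: ln_div)

text \<open>Supplies the hypothesis \<open>3 / 2 + 2 * \<delta> \<le> D\<close> of
  \<open>regret_arithmetic\<close>. Tangents at 8 and 16, powers of two, reduce it to rational
  inequalities in \<open>T\<close> via \<open>ln 2 \<ge> 2 / 3\<close>. The case
  \<open>n = 2\<close> is tight enough to need the exact cost; for larger \<open>n\<close> the bound
  \<open>1 / T\<close> on the fraction suffices.\<close>

lemma ln_dominates_mixing_cost:
  fixes n T :: real
  assumes "n = 2 \<or> 3 \<le> n" "2 \<le> T"
  shows "3 / 2 + 2 * ((T - 2) * ((n - 1) / (n * T + 1))) \<le> ln ((1 + T) * n)"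
proof -
  consider "n = 2" | "3 \<le> n" using assms by blast
  then show ?thesis
  proof cases
    case 1
    have l8: "2 \<le> ln (8::real)"
      using ln2_ge_two_thirds ln_realpow[of "2::real" 3] by simp
    have "3 / 2 + 2 * ((T - 2) * ((n - 1) / (n * T + 1))) = 5/2 - 5 / (2 * T + 1)"
      using assms 1 by (simp add: field_simps)
    also have "\<dots> \<le> 3 - 8 / ((1 + T) * n)"
    proof -
      \<comment> \<open>Clearing denominators leaves \<open>2 T^2 - 3 T + 3\<close>, with vertex at
        3/4.\<close>
      have "0 \<le> (T - 3/4)\<^sup>2" by simp
      then have "0 \<le> 2 * T * T - 3 * T + 3"
        using assms by (simp add: power2_eq_square algebra_simps)
      then show ?thesis using assms 1 by (simp add: field_simps)
    qed
    also have "\<dots> \<le> ln 8 + 1 - 8 / ((1 + T) * n)" using l8 by simp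
    also have "\<dots> \<le> ln ((1 + T) * n)" using assms 1 by (intro ln_tangent) auto
    finally show ?thesis .
  next
    case 2
    have l16: "8 / 3 \<le> ln (16::real)"
      using ln2_ge_two_thirds ln_realpow[of "2::real" 4] by simp
    have pos: "n * T + 1 > 0" using 2 assms by (simp add: add_pos_pos)
    have "(n - 1) / (n * T + 1) \<le> 1 / T"
      using 2 assms pos by (simp add: field_simps)
    then have "2 * ((T - 2) * ((n - 1) / (n * T + 1))) \<le> 2 * ((T - 2) * (1 / T))"
      using assms by (intro mult_left_mono) auto
    also have "2 * ((T - 2) * (1 / T)) = 2 - 4 / T"
      using assms by (simp add: field_simps)
    finally have "3 / 2 + 2 * ((T - 2) * ((n - 1) / (n * T + 1))) \<le> 7/2 - 4 / T"
      by simp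
    also have "\<dots> \<le> 11/3 - 16 / ((1 + T) * 3)"
    proof -
      \<comment> \<open>Here clearing denominators leaves \<open>T^2 - 7 T + 24\<close>, with vertex
        at 7/2.\<close>
      have "0 \<le> (T - 7/2)\<^sup>2" by simp
      then have "0 \<le> T * T - 7 * T + 24"
        using assms by (simp add: power2_eq_square algebra_simps)
      then show ?thesis using assms by (simp add: field_simps)
    qed
    also have "\<dots> \<le> ln 16 + 1 - 16 / ((1 + T) * 3)" using l16 by simp
    also have "\<dots> \<le> ln ((1 + T) * 3)" using assms 2 by (intro ln_tangent) auto
    also have "\<dots> \<le> ln ((1 + T) * n)"
      using assms 2 by (intro ln_mono mult_left_mono) auto
    finally show ?thesis .
  qed
qed

section \<open>Cross entropy along multiplicative updates and mixing\<close>

text \<open>Relative entropy up to a term in \<open>u\<close> alone, which cancels in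
  differences.\<close>

definition cross_entropy :: "real^'n \<Rightarrow> real^'n \<Rightarrow> real" where
  "cross_entropy u y = - (\<Sum>i\<in>UNIV. u $ i * ln (y $ i))"

definition hedge_step :: "real \<Rightarrow> real^'n \<Rightarrow> real^'n \<Rightarrow> real^'n" where
  "hedge_step \<eta> g y = (\<chi> i. y $ i * exp (- \<eta> * g $ i) / (\<Sum>j\<in>UNIV. y $ j * exp (- \<eta> * g $ j)))"

lemma prob_simplexD:
  assumes "u \<in> prob_simplex"
  shows "0 \<le> u $ i" "(\<Sum>i\<in>UNIV. u $ i) = 1" "u $ i \<le> 1"
proof -
  show *: "0 \<le> u $ i" "(\<Sum>i\<in>UNIV. u $ i) = 1" for i
    using assms by (auto simp: prob_simplex_def)
  show "u $ i \<le> 1"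
    using member_le_sum[of i UNIV "\<lambda>i. u $ i"] * by auto
qed

lemma prob_simplex_inner_self_le_1:
  assumes "u \<in> prob_simplex"
  shows "u \<bullet> u \<le> 1"
proof -
  have "u \<bullet> u \<le> (\<Sum>i\<in>UNIV. u $ i * 1)"
    unfolding inner_vec_def inner_real_def
    using prob_simplexD[OF assms] by (intro sum_mono mult_left_mono) auto
  then show ?thesis using prob_simplexD(2)[OF assms] by simp
qed

lemma axis_in_prob_simplex: "axis i 1 \<in> prob_simplex"
  by (auto simp: prob_simplex_def axis_def)

lemma hedge_normalizer_pos:
  assumes "y \<in> prob_simplex"
  shows "0 < (\<Sum>j\<in>UNIV. y $ j * exp (g j))"
proof -
  obtain k where "y $ k \<noteq> 0"
    using prob_simplexD(2)[OF assms] by (metis sum.neutral zero_neq_one)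
  then show ?thesis
    using prob_simplexD(1)[OF assms]
    by (intro sum_pos2[of _ k]) (auto simp: less_le)
qed

lemma hedge_step_in_prob_simplex:
  assumes "y \<in> prob_simplex"
  shows "hedge_step \<eta> g y \<in> prob_simplex"
  using hedge_normalizer_pos[OF assms, of "\<lambda>j. - \<eta> * g $ j"] prob_simplexD(1)[OF assms]
  by (auto simp: prob_simplex_def hedge_step_def simp flip: sum_divide_distrib)

lemma hedge_step_pos:
  assumes "y \<in> prob_simplex" "0 < y $ i"
  shows "0 < hedge_step \<eta> g y $ i"
  using hedge_normalizer_pos[OF assms(1), of "\<lambda>j. - \<eta> * g $ j"] assms(2)
  by (simp add: hedge_step_def)

text \<open>The logarithm of a new weight is \<open>ln (y $ i) - \<eta> * g $ i\<close> minus the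
  logarithm of the normalizer; average this with the weights \<open>u\<close>.\<close>

lemma cross_entropy_hedge_step:
  assumes u: "u \<in> prob_simplex" and y: "y \<in> prob_simplex" and pos: "\<And>i. 0 < y $ i"
  shows "cross_entropy u (hedge_step \<eta> g y) =
    cross_entropy u y + \<eta> * (u \<bullet> g) + ln (\<Sum>j\<in>UNIV. y $ j * exp (- \<eta> * g $ j))"
proof -
  define Z where "Z = (\<Sum>j\<in>UNIV. y $ j * exp (- \<eta> * g $ j))"
  have Z: "0 < Z" unfolding Z_def by (rule hedge_normalizer_pos[OF y])
  have "ln (hedge_step \<eta> g y $ i) = ln (y $ i) - \<eta> * g $ i - ln Z" for i
  proof -
    have "hedge_step \<eta> g y $ i = y $ i * exp (- \<eta> * g $ i) / Z"
      by (simp add: hedge_step_def Z_def)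
    then show ?thesis using Z pos[of i] by (simp add: ln_div ln_mult)
  qed
  then have "cross_entropy u (hedge_step \<eta> g y)
      = - (\<Sum>i\<in>UNIV. u $ i * ln (y $ i) - \<eta> * (u $ i * g $ i) - u $ i * ln Z)"
    unfolding cross_entropy_def by (simp add: right_diff_distrib mult.left_commute)
  also have "\<dots> = cross_entropy u y + \<eta> * (u \<bullet> g) + (\<Sum>i\<in>UNIV. u $ i) * ln Z"
    by (simp add: sum_subtractf cross_entropy_def inner_vec_def sum_distrib_left sum_distrib_right)
  finally show ?thesis
    using prob_simplexD(2)[OF u] by (simp add: Z_def)
qed

text \<open>The width \<open>R = 2 p\<close> in the moment bound yields the term
  \<open>\<eta> / 4\<close>. The update only sees the linear loss
  \<open>u \<bullet> (A *v y)\<close>; the AM-GM bound converts it into the two quadratic losses,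
  with \<open>\<theta>\<close> left free for tuning.\<close>

lemma hedge_step_progress:
  fixes A :: "real^'n^'n"
  assumes sym: "transpose A = A" and psd: "psd A" and le: "loewner_le A (mat 1)"
    and u: "u \<in> prob_simplex" and y: "y \<in> prob_simplex" and pos: "\<And>i. 0 < y $ i"
    and \<eta>: "0 < \<eta>" and \<theta>: "0 < \<theta>"
  shows "\<eta> * (1 - \<eta> / 4 - \<theta> / 2) * (y \<bullet> (A *v y)) - \<eta> / (2 * \<theta>) * (u \<bullet> (A *v u))
    \<le> cross_entropy u y - cross_entropy u (hedge_step \<eta> (A *v y) y)"
proof -
  define p where "p = y \<bullet> (A *v y)"
  define Z where "Z = (\<Sum>j\<in>UNIV. y $ j * exp (- \<eta> * (A *v y) $ j))"
  have Z: "0 < Z" unfolding Z_def by (rule hedge_normalizer_pos[OF y])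
  have "Z \<le> exp (- \<eta> * (\<Sum>i\<in>UNIV. y $ i * (A *v y) $ i) + \<eta>\<^sup>2 * (2 * p) / 8)"
    unfolding Z_def p_def
    using prob_simplexD[OF y] \<eta> mult_vec_coordinate_range[OF sym psd le]
    by (intro exp_mgf_bound_finite) auto
  also have "(\<Sum>i\<in>UNIV. y $ i * (A *v y) $ i) = p"
    by (simp add: p_def inner_vec_def)
  finally have "ln Z \<le> - \<eta> * p + \<eta>\<^sup>2 * (2 * p) / 8"
    using Z by (metis exp_le_cancel_iff exp_ln)
  moreover have "\<eta> * (u \<bullet> (A *v y)) \<le> \<eta> * (\<theta> / 2 * p + 1 / (2 * \<theta>) * (u \<bullet> (A *v u)))"
    unfolding p_def using \<eta> by (intro mult_left_mono psd_bilinear_AM_GM[OF sym psd \<theta>]) auto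
  ultimately show ?thesis
    unfolding cross_entropy_hedge_step[OF u y pos] Z_def[symmetric] p_def[symmetric]
    by (simp add: algebra_simps power2_eq_square)
qed

lemma cross_entropy_nonneg:
  assumes "u \<in> prob_simplex" "y \<in> prob_simplex" "\<And>i. 0 < y $ i"
  shows "0 \<le> cross_entropy u y"
  using prob_simplexD(1)[OF assms(1)] prob_simplexD(3)[OF assms(2)] assms(3)
  by (auto simp: cross_entropy_def intro!: sum_nonpos mult_nonneg_nonpos)

lemma cross_entropy_le_add:
  assumes u: "u \<in> prob_simplex" and "\<And>i. ln (v $ i) \<le> ln (y $ i) + m"
  shows "cross_entropy u y \<le> cross_entropy u v + m"
proof -
  have "(\<Sum>i\<in>UNIV. u $ i * ln (v $ i)) \<le> (\<Sum>i\<in>UNIV. u $ i * (ln (y $ i) + m))"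
    using assms prob_simplexD(1)[OF u] by (intro sum_mono mult_left_mono) auto
  also have "\<dots> = (\<Sum>i\<in>UNIV. u $ i * ln (y $ i)) + m"
    using prob_simplexD(2)[OF u] by (simp add: distrib_left sum.distrib flip: sum_distrib_right)
  finally show ?thesis by (simp add: cross_entropy_def)
qed

lemma cross_entropy_le_of_lower_bound:
  assumes u: "u \<in> prob_simplex" and m: "0 < m" "\<And>i. m \<le> y $ i"
  shows "cross_entropy u y \<le> - ln m"
  \<comment> \<open>The all-ones vector serves as reference because its cross entropy is 0.\<close>
  using cross_entropy_le_add[OF u, of "\<chi> i. 1" y "- ln m"] m
  by (auto simp: cross_entropy_def order_less_le_trans)

text \<open>Since \<open>v $ i \<le> 1\<close>, the uniform part itself contributes at least \<open>\<alpha> / n * v $ i\<close>; dropping it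
  would cost \<open>- ln (1 - \<alpha>)\<close>, which is too much when \<open>n = 2\<close>.\<close>
lemma cross_entropy_mixing:
  fixes u v :: "real^'n"
  assumes u: "u \<in> prob_simplex" and v: "v \<in> prob_simplex" and pos: "\<And>i. 0 < v $ i"
    and \<alpha>: "0 \<le> \<alpha>" "\<alpha> < 1"
  shows "cross_entropy u (\<chi> i. \<alpha> / real CARD('n) + (1 - \<alpha>) * v $ i)
    \<le> cross_entropy u v - ln (1 - \<alpha> + \<alpha> / real CARD('n))"
proof -
  define q where "q = 1 - \<alpha> + \<alpha> / real CARD('n)"
  have q: "0 < q" using \<alpha> by (simp add: q_def add_pos_nonneg)
  have "ln (v $ i) \<le> ln (\<alpha> / real CARD('n) + (1 - \<alpha>) * v $ i) + - ln q" for i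
  proof -
    have "\<alpha> / real CARD('n) * v $ i \<le> \<alpha> / real CARD('n)"
      using \<alpha> prob_simplexD(3)[OF v] by (intro mult_left_le) auto
    then have "q * v $ i \<le> \<alpha> / real CARD('n) + (1 - \<alpha>) * v $ i"
      by (simp add: q_def algebra_simps)
    then have "ln (q * v $ i) \<le> ln (\<alpha> / real CARD('n) + (1 - \<alpha>) * v $ i)"
      using q pos[of i] by (intro ln_mono) (auto intro: mult_pos_pos)
    then show ?thesis using q pos[of i] by (simp add: ln_mult)
  qed
  then show ?thesis
    using cross_entropy_le_add[OF u, of v _ "- ln q"] by (simp add: q_def)
qed

section \<open>Arithmetic of the tuned parameters\<close>

text \<open>\<open>w\<close> is \<open>sqrt (2 * D + 2)\<close>, \<open>l\<close> is
  \<open>sqrt L\<close>, and \<open>\<theta> = 1 - \<eta>\<close>. Solving \<open>P\<close> for the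
  total loss leaves \<open>M\<close> with a positive coefficient, so \<open>M = l\<^sup>2\<close> is
  the worst case. The final \<open>- 1\<close> is reserved to pay for the first round.\<close>

lemma regret_arithmetic:
  fixes w l D \<delta> M P :: real
  assumes w: "0 < w" and l: "0 < l" and wD: "w\<^sup>2 = 2 * D + 2" and \<delta>: "0 \<le> \<delta>" "\<delta> \<le> 1"
    and D: "3 / 2 + 2 * \<delta> \<le> D" and M: "M \<le> l\<^sup>2"
    and \<eta>: "\<eta> = w / (w + l)" and \<theta>: "\<theta> = l / (w + l)"
    and P: "\<eta> * (1 - \<eta> / 4 - \<theta> / 2) * P - \<eta> / (2 * \<theta>) * M \<le> D + \<delta>"
  shows "P - M \<le> 2 * w * l + 2 * D - 1"
proof -
  have "1 - \<eta> / 4 - \<theta> / 2 = (3 * w + 2 * l) / (4 * (w + l))"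
  proof -
    define W where "W = w + l"
    have W: "w = W - l" "0 < W" using w l by (simp_all add: W_def)
    show ?thesis
      unfolding \<eta> \<theta> W_def[symmetric] unfolding W(1) using W(2) by (simp add: field_simps)
  qed
  then have coeff: "\<eta> * (1 - \<eta> / 4 - \<theta> / 2) = w * (3 * w + 2 * l) / (4 * (w + l)\<^sup>2)"
    "\<eta> / (2 * \<theta>) = w / (2 * l)"
    using w l by (simp_all add: \<eta> \<theta> power2_eq_square)
  have D_eq: "D = w\<^sup>2 / 2 - 1" using wD by linarith
  have wl: "0 < (w + l)\<^sup>2" "0 < w * (3 * w + 2 * l)" using w l by (auto intro!: mult_pos_pos add_pos_pos)
  have "w * (3 * w + 2 * l) * P \<le> 4 * (w + l)\<^sup>2 * (D + \<delta> + w / (2 * l) * M)"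
    using P wl unfolding coeff by (simp add: field_simps)
  also have "\<dots> \<le> w * (3 * w + 2 * l) * (M + 2 * w * l + 2 * D - 1)"
  proof -
    have M': "M * (w\<^sup>2 * (2 * w + l) / l) \<le> l\<^sup>2 * (w\<^sup>2 * (2 * w + l) / l)"
      using M w l by (intro mult_right_mono) auto
    \<comment> \<open>The worst-case slack after substituting \<open>w\<^sup>2 = 2 * D + 2\<close>.
      The lower bound on \<open>D\<close> is exactly nonnegativity of the coefficient of
      \<open>w\<^sup>2\<close>.\<close>
    have "0 \<le> 8 * (1 - \<delta>) * (w * l) + (2 * D + 6 - 4 * \<delta>) * l\<^sup>2 + (2 * D - 3 - 4 * \<delta>) * w\<^sup>2
        + 2 * (2 * D - 1) * (w * l)"
      using w l D \<delta> by (intro add_nonneg_nonneg mult_nonneg_nonneg) auto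
    also have "\<dots> = 4 * w\<^sup>2 * (w * l) + 3 * w\<^sup>2 * l\<^sup>2 + w * (3 * w + 2 * l) * (2 * D - 1)
        - 4 * (w + l)\<^sup>2 * (D + \<delta>)"
      by (simp add: D_eq algebra_simps power2_eq_square)
    also have "\<dots> = w * (3 * w + 2 * l) * (2 * w * l + 2 * D - 1) - 4 * (w + l)\<^sup>2 * (D + \<delta>)
        - l\<^sup>2 * (w\<^sup>2 * (2 * w + l) / l)"
      using l by (simp add: field_simps power2_eq_square)
    also have "\<dots> \<le> w * (3 * w + 2 * l) * (2 * w * l + 2 * D - 1) - 4 * (w + l)\<^sup>2 * (D + \<delta>)
        - M * (w\<^sup>2 * (2 * w + l) / l)"
      using M' by simp
    also have "\<dots> = w * (3 * w + 2 * l) * (M + 2 * w * l + 2 * D - 1)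
        - 4 * (w + l)\<^sup>2 * (D + \<delta> + w / (2 * l) * M)"
      using l by (simp add: field_simps power2_eq_square)
    finally show ?thesis by simp
  qed
  finally have "P \<le> M + 2 * w * l + 2 * D - 1"
    using wl(2) by (simp only: mult_le_cancel_left_pos)
  then show ?thesis by simp
qed

section \<open>The simplex and the comparator loss\<close>

lemma mixing_in_prob_simplex:
  fixes v :: "real^'n"
  assumes v: "v \<in> prob_simplex" and \<alpha>: "0 \<le> \<alpha>" "\<alpha> \<le> 1"
  shows "(\<chi> i. \<alpha> / real CARD('n) + (1 - \<alpha>) * v $ i) \<in> prob_simplex"
  using prob_simplexD[OF v] \<alpha>
  by (auto simp: prob_simplex_def sum.distrib simp flip: sum_distrib_left)

text \<open>In dimension 1, where \<open>D\<close> may be too small for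
  \<open>regret_arithmetic\<close>, learner and comparator coincide.\<close>

lemma prob_simplex_unique:
  fixes u v :: "real^'n"
  assumes "CARD('n) = 1" "u \<in> prob_simplex" "v \<in> prob_simplex"
  shows "u = v"
proof -
  obtain k :: 'n where "UNIV = {k}"
    using assms(1) by (auto simp: card_1_singleton_iff)
  note k = this
  then have "x = k" for x :: 'n by blast
  moreover have "u $ k = 1" "v $ k = 1"
    using prob_simplexD(2)[OF assms(2)] prob_simplexD(2)[OF assms(3)] unfolding k by simp_all
  ultimately show ?thesis
    by (metis vec_eq_iff)
qed

lemma le_min_loss:
  assumes "\<And>u. u \<in> prob_simplex \<Longrightarrow> z \<le> (\<Sum>t=r..s. u \<bullet> (C t *v u))"
  shows "z \<le> min_loss C r s"
  unfolding min_loss_def using axis_in_prob_simplex assms by (intro cINF_greatest) auto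

lemma min_loss_le:
  assumes "\<And>t. r \<le> t \<Longrightarrow> t \<le> s \<Longrightarrow> psd (C t)" "u \<in> prob_simplex"
  shows "min_loss C r s \<le> (\<Sum>t=r..s. u \<bullet> (C t *v u))"
  unfolding min_loss_def
  using assms by (intro cINF_lower bdd_belowI[of _ 0]) (auto simp: psd_def intro!: sum_nonneg)

text \<open>Dropping initial rounds drops nonnegative terms for each comparator; this lets round 1
  be split off.\<close>

lemma min_loss_antimono_start:
  assumes psd: "\<And>t. r \<le> t \<Longrightarrow> t \<le> s \<Longrightarrow> psd (C t)" and "r \<le> r'"
  shows "min_loss C r' s \<le> min_loss C r s"
proof (rule le_min_loss)
  fix u :: "real^'a" assume u: "u \<in> prob_simplex"
  have "min_loss C r' s \<le> (\<Sum>t=r'..s. u \<bullet> (C t *v u))"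
    using assms u by (intro min_loss_le) auto
  also have "\<dots> \<le> (\<Sum>t=r..s. u \<bullet> (C t *v u))"
    using assms by (intro sum_mono2) (auto simp: psd_def)
  finally show "min_loss C r' s \<le> (\<Sum>t=r..s. u \<bullet> (C t *v u))" .
qed

section \<open>Regret on an arbitrary interval\<close>

theorem theorem4p6:
  fixes C :: "nat \<Rightarrow> real^'n^'n" and y :: "nat \<Rightarrow> real^'n"
    and T :: nat and L \<alpha> c b a \<eta> :: real
  assumes T: "T \<ge> 1"
    and sym: "\<And>t. 1 \<le> t \<Longrightarrow> t \<le> T \<Longrightarrow> transpose (C t) = C t"
    and lower: "\<And>t. 1 \<le> t \<Longrightarrow> t \<le> T \<Longrightarrow> loewner_le 0 (C t)"
    and upper: "\<And>t. 1 \<le> t \<Longrightarrow> t \<le> T \<Longrightarrow> loewner_le (C t) (mat 1)"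
    and y1: "y 1 \<in> prob_simplex"
    and upd: "\<And>t. 1 \<le> t \<Longrightarrow> t \<le> T \<Longrightarrow>
       y (Suc t) = (\<chi> i. \<alpha> / real CARD('n) + (1 - \<alpha>) *
          ((y t $ i * exp (- \<eta> * (C t *v y t) $ i)) /
           (\<Sum>j\<in>UNIV. y t $ j * exp (- \<eta> * (C t *v y t) $ j))))"
    and Lpos: "L > 0"
    and Lbound: "\<And>r s. 1 \<le> r \<Longrightarrow> r \<le> s \<Longrightarrow> s \<le> T \<Longrightarrow> min_loss C r s \<le> L"
    and \<alpha>_def: "\<alpha> = 1 / (real T + 1)"
    and c_def: "c = sqrt (2 * ln ((1 + real T) * real CARD('n)) + 2) / sqrt L"
    and b_def: "b = c / 2"
    and a_def: "a = b / (2 * b + 1)"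
    and \<eta>_def: "\<eta> = 2 * a"
  shows "\<forall>r s. 1 \<le> r \<and> r \<le> s \<and> s \<le> T \<longrightarrow>
     (\<Sum>t=r..s. y t \<bullet> (C t *v y t)) - min_loss C r s
       \<le> 2 * sqrt (2 * L * (ln ((1 + real T) * real CARD('n)) + 1))
          + 2 * ln ((1 + real T) * real CARD('n))"
proof (intro allI impI; elim conjE)
  fix r s assume rs: "1 \<le> r" "r \<le> s" "s \<le> T"
  define n where "n = real CARD('n)"
  define D where "D = ln ((1 + real T) * n)"
  define w where "w = sqrt (2 * D + 2)"
  define l where "l = sqrt L"
  define \<theta> where "\<theta> = l / (w + l)"
  define \<mu> where "\<mu> = - ln (1 - \<alpha> + \<alpha> / n)"
  define v where "v t = hedge_step \<eta> (C t *v y t) (y t)" for t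
  define p where "p t = y t \<bullet> (C t *v y t)" for t
  have n1: "1 \<le> n" unfolding n_def by (simp add: Suc_leI)
  have D0: "0 \<le> D"
    unfolding D_def using n1 by (simp add: mult_ge1_I)
  have w0: "0 < w" and l0: "0 < l" and wD: "w\<^sup>2 = 2 * D + 2" and lL: "l\<^sup>2 = L"
    using D0 Lpos by (auto simp: w_def l_def)
  have \<theta>0: "0 < \<theta>" using w0 l0 by (simp add: \<theta>_def)
  \<comment> \<open>The prescribed constants collapse to \<open>\<eta> = c / (c + 1)\<close> with
    \<open>c = w / l\<close>.\<close>
  have \<eta>_eq: "\<eta> = w / (w + l)"
  proof -
    have "c = w / l" by (simp add: c_def w_def l_def D_def n_def)
    then have "0 < c" "w = c * l" "w + l = (c + 1) * l"
      using w0 l0 by (auto simp: field_simps zero_less_mult_iff)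
    then show ?thesis
      using l0 unfolding \<eta>_def a_def b_def by (simp add: divide_simps)
  qed
  have \<eta>0: "0 < \<eta>" using w0 l0 by (simp add: \<eta>_eq)
  have \<alpha>: "0 < \<alpha>" "\<alpha> < 1" using T by (auto simp: \<alpha>_def)
  have target: "2 * sqrt (2 * L * (D + 1)) = 2 * w * l"
    by (simp add: w_def l_def algebra_simps flip: real_sqrt_mult)
  have psd: "psd (C t)" if "1 \<le> t" "t \<le> T" for t
    using lower[OF that] by (simp add: loewner_le_def)
  have y_Suc: "y (Suc t) = (\<chi> i. \<alpha> / real CARD('n) + (1 - \<alpha>) * v t $ i)"
    if "1 \<le> t" "t \<le> T" for t
    using upd[OF that] by (simp add: v_def hedge_step_def)
  have ysim: "y t \<in> prob_simplex" if "1 \<le> t" "t \<le> Suc T" for t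
    using that
  proof (induction t rule: dec_induct)
    case (step t)
    then have "v t \<in> prob_simplex" unfolding v_def by (intro hedge_step_in_prob_simplex) auto
    then show ?case
      using step \<alpha> by (simp add: y_Suc mixing_in_prob_simplex)
  qed (use y1 in simp)
  have vsim: "v t \<in> prob_simplex" if "1 \<le> t" "t \<le> T" for t
    unfolding v_def using that by (intro hedge_step_in_prob_simplex ysim) auto
  have ylow: "\<alpha> / n \<le> y t $ i" if "2 \<le> t" "t \<le> Suc T" for t i
  proof -
    obtain t' where "t = Suc t'" "1 \<le> t'" "t' \<le> T"
      using \<open>2 \<le> t\<close> \<open>t \<le> Suc T\<close> by (cases t) auto
    then show ?thesis
      using y_Suc[of t'] prob_simplexD(1)[OF vsim[of t']] \<alpha> by (simp add: n_def)
  qed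
  have ypos: "0 < y t $ i" if "2 \<le> t" "t \<le> Suc T" for t i
    using ylow[OF that, of i] \<alpha> n1 by (auto intro: order_less_le_trans[rotated])
  have vpos: "0 < v t $ i" if "2 \<le> t" "t \<le> T" for t i
    unfolding v_def using that by (intro hedge_step_pos ysim ypos) auto
  have p1: "p t \<le> 1" if "1 \<le> t" "t \<le> T" for t
    using quadratic_form_le_norm[OF upper[OF that], of "y t"]
      prob_simplex_inner_self_le_1[OF ysim[of t]] that by (simp add: p_def)
  have m0: "0 \<le> min_loss C r s"
    using psd rs by (intro le_min_loss sum_nonneg) (auto simp: psd_def)
  have \<mu>_le: "\<mu> \<le> (n - 1) / (n * T + 1)" and \<mu>0: "0 \<le> \<mu>"
  proof -
    have e: "1 - \<alpha> + \<alpha> / n = (n * T + 1) / (n * T + n)"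
    proof -
      have "n \<noteq> 0" "real T + 1 \<noteq> 0" "n * T + n = n * (real T + 1)"
        using n1 by (simp_all add: algebra_simps)
      then show ?thesis
        unfolding \<alpha>_def by (simp add: divide_simps)
    qed
    have pos: "0 < n * T + 1" "0 < n * T + n" using n1 by (auto intro!: add_nonneg_pos)
    have "\<mu> = ln ((n * T + n) / (n * T + 1))"
      unfolding \<mu>_def e using pos by (simp add: ln_div)
    also have "\<dots> \<le> (n * T + n) / (n * T + 1) - 1"
      using pos by (intro ln_le_minus_one) simp
    also have "\<dots> = (n - 1) / (n * T + 1)"
      using pos by (simp add: field_simps)
    finally show "\<mu> \<le> (n - 1) / (n * T + 1)" .
    show "0 \<le> \<mu>"
      using \<open>\<mu> = ln ((n * T + n) / (n * T + 1))\<close> pos n1 by simp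
  qed
  \<comment> \<open>With \<open>2 \<le> r'\<close> and \<open>s \<le> T\<close>, at most
    \<open>T - 2\<close> mixing steps lie inside the interval.\<close>
  define \<delta> where "\<delta> = (real T - 2) * ((n - 1) / (n * T + 1))"
  have main: "(\<Sum>t=r'..s. p t) - min_loss C r' s \<le> 2 * w * l + 2 * D - 1"
    if r': "2 \<le> r'" "r' \<le> s" and n2: "2 \<le> CARD('n)" for r'
  proof (rule regret_arithmetic[OF w0 l0 wD])
    have T2: "2 \<le> real T" using r' rs by linarith
    have "CARD('n) = 2 \<or> 3 \<le> CARD('n)" using n2 by arith
    then have "n = 2 \<or> 3 \<le> n" by (auto simp: n_def)
    then show "3 / 2 + 2 * \<delta> \<le> D"
      unfolding \<delta>_def D_def using T2 by (rule ln_dominates_mixing_cost)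
    show "0 \<le> \<delta>" unfolding \<delta>_def using T2 n1 by simp
    have "(real T - 2) * (n - 1) \<le> n * T + 1"
      using T2 n1 by (simp add: algebra_simps)
    then show "\<delta> \<le> 1" unfolding \<delta>_def using T2 n1
      by (simp add: divide_le_eq add_pos_pos)
    show "min_loss C r' s \<le> l\<^sup>2" unfolding lL using r' rs by (intro Lbound) auto
    show "\<eta> = w / (w + l)" "\<theta> = l / (w + l)" by (fact \<eta>_eq \<theta>_def)+
    define A B where "A = \<eta> * (1 - \<eta> / 4 - \<theta> / 2)" and "B = \<eta> / (2 * \<theta>)"
    have B0: "0 < B" using \<eta>0 \<theta>0 by (simp add: B_def)
    \<comment> \<open>The telescoped inequality is solved for the comparator loss, which is possible
      as \<open>B > 0\<close>. Being valid for every \<open>u\<close>, it passes to the infimum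
      without a minimizer.\<close>
    have "(A * (\<Sum>t=r'..s. p t) - (D + \<delta>)) / B \<le> min_loss C r' s"
    proof (rule le_min_loss)
      fix u :: "real^'n" assume u: "u \<in> prob_simplex"
      have "(\<Sum>t=r'..s. A * p t - B * (u \<bullet> (C t *v u)))
        \<le> cross_entropy u (y r') - cross_entropy u (v s) + real (s - r') * \<mu>"
      proof (rule telescoping_with_cost[OF r'(2)])
        fix t assume t: "r' \<le> t" "t \<le> s"
        show "A * p t - B * (u \<bullet> (C t *v u)) \<le> cross_entropy u (y t) - cross_entropy u (v t)"
          unfolding A_def B_def p_def v_def using t r' rs \<eta>0 \<theta>0
          by (intro hedge_step_progress sym psd upper u ysim ypos) auto
      next
        fix t assume t: "r' \<le> t" "t < s"
        then show "cross_entropy u (y (Suc t)) \<le> cross_entropy u (v t) + \<mu>"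
          using cross_entropy_mixing[OF u vsim[of t] vpos, of \<alpha>] \<alpha> r' rs y_Suc[of t]
          by (simp add: \<mu>_def n_def)
      qed
      also have "\<dots> \<le> D - 0 + \<delta>"
      proof (intro add_mono diff_mono)
        have "cross_entropy u (y r') \<le> - ln (\<alpha> / n)"
          using r' rs \<alpha> n1 by (intro cross_entropy_le_of_lower_bound u ylow) auto
        \<comment> \<open>The choice of \<open>\<alpha>\<close> makes the floor
          \<open>\<alpha> / n\<close> equal to \<open>1 / ((1 + T) * n)\<close>.\<close>
        also have "\<dots> = D"
          using n1 by (simp add: \<alpha>_def D_def ln_div ln_mult add.commute)
        finally show "cross_entropy u (y r') \<le> D" .
        show "0 \<le> cross_entropy u (v s)"
          using r' rs by (intro cross_entropy_nonneg u vsim vpos) auto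
        have "real (s - r') * \<mu> \<le> (real T - 2) * \<mu>"
          using r' rs \<mu>0 by (intro mult_right_mono) auto
        also have "\<dots> \<le> \<delta>"
          unfolding \<delta>_def using T2 \<mu>_le by (intro mult_left_mono) auto
        finally show "real (s - r') * \<mu> \<le> \<delta>" .
      qed
      finally show "(A * (\<Sum>t=r'..s. p t) - (D + \<delta>)) / B \<le> (\<Sum>t=r'..s. u \<bullet> (C t *v u))"
        using B0 by (simp add: sum_subtractf field_simps flip: sum_distrib_left)
    qed
    then show "\<eta> * (1 - \<eta> / 4 - \<theta> / 2) * (\<Sum>t=r'..s. p t) - \<eta> / (2 * \<theta>) * min_loss C r' s \<le> D + \<delta>"
      unfolding A_def[symmetric] B_def[symmetric] using B0 by (simp add: field_simps)
  qed
  have "(\<Sum>t=r..s. p t) - min_loss C r s \<le> 2 * w * l + 2 * D"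
  proof (cases "CARD('n) = 1")
    case True
    have "(\<Sum>t=r..s. p t) \<le> min_loss C r s"
    proof (rule le_min_loss)
      fix u :: "real^'n" assume "u \<in> prob_simplex"
      then have "y t = u" if "r \<le> t" "t \<le> s" for t
        using prob_simplex_unique[OF True ysim[of t]] that rs by auto
      then show "(\<Sum>t=r..s. p t) \<le> (\<Sum>t=r..s. u \<bullet> (C t *v u))"
        unfolding p_def by (intro sum_mono) auto
    qed
    then show ?thesis using w0 l0 D0 by (simp add: add_increasing)
  next
    case False
    then have n2: "2 \<le> CARD('n)" using zero_less_card_finite[where 'a='n] by linarith
    consider "2 \<le> r" | "r = 1" "s = 1" | "r = 1" "2 \<le> s" using rs by linarith
    then show ?thesis
    proof cases
      case 1
      then show ?thesis using main[OF _ _ n2, of r] rs by simp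
    next
      case 2
      \<comment> \<open>A lone first round loses at most 1, which \<open>2 * D\<close>
        covers.\<close>
      have "2 * 1 \<le> (1 + real T) * n"
        using T n2 unfolding n_def by (intro mult_mono) auto
      then have "ln 2 \<le> D"
        unfolding D_def by (intro ln_mono) auto
      then have "1 \<le> 2 * D" using ln2_ge_two_thirds by simp
      then show ?thesis
        using p1[of 1] m0 2 T w0 l0 by (simp add: add_increasing)
    next
      case 3
      \<comment> \<open>The first loss, at most 1, is absorbed by the \<open>- 1\<close> in
        \<open>main\<close> from round 2 on.\<close>
      have "(\<Sum>t=r..s. p t) = p 1 + (\<Sum>t=2..s. p t)"
        using 3 by (simp add: sum.atLeast_Suc_atMost numeral_2_eq_2)
      moreover have "min_loss C 2 s \<le> min_loss C r s"
        using psd 3 rs by (intro min_loss_antimono_start) auto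
      ultimately show ?thesis
        using main[OF _ _ n2, of 2] 3 p1[of 1] T by simp
    qed
  qed
  then show "(\<Sum>t=r..s. y t \<bullet> (C t *v y t)) - min_loss C r s
       \<le> 2 * sqrt (2 * L * (ln ((1 + real T) * real CARD('n)) + 1))
          + 2 * ln ((1 + real T) * real CARD('n))"
    unfolding n_def[symmetric] D_def[symmetric] target p_def .
qed

end
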